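(* For every $M>\frac23$, the Biot stress-stretch relation $U\mapsto T_{\rm Biot}(U)$, $T_{\rm Biot}:\mathrm{Sym}^{++}(3)\to\mathrm{Sym}(3)$, of the compressible Neo-Hooke-Ciarlet-Geymonat material with parameter $M$ is not Hilbert-monotone.
   Context: $\mathrm{Sym}(3)$ is the space of real symmetric $3\times3$ matrices with the inner product $\langle X,Y\rangle=\mathrm{tr}(XY^T)$, and $\mathrm{Sym}^{++}(3)$ its subset of positive definite matrices. A map $\Sigma:\mathrm{Sym}^{++}(3)\to\mathrm{Sym}(3)$ is called Hilbert-monotone if $\langle\Sigma(U)-\Sigma(\overline U),U-\overline U\rangle\ge0$ for all $U,\overline U\in\mathrm{Sym}^{++}(3)$. For $M>\frac23$, the Biot stress tensor of the (one-parameter) Neo-Hooke-Ciarlet-Geymonat energy $\frac12\|U\|^2-\log\det U+\left(\frac M4-\frac16\right)\left((\det U)^2-2\log\det U-1\right)$ is, for $U\in\mathrm{Sym}^{++}(3)$, $$T_{\rm Biot}(U)=U+\Big[\Big(\tfrac M2-\tfrac13\Big)\Big(\det U-\tfrac1{\det U}\Big)-\tfrac1{\det U}\Big](\det U)\,U^{-1}.$$ *)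

theory Defs
  imports "HOL-Analysis.Analysis"
begin

definition Sym3 :: "(real ^ 3 ^ 3) set" where
  "Sym3 = {U. transpose U = U}"

definition Sym3_pd :: "(real ^ 3 ^ 3) set" where
  "Sym3_pd = {U \<in> Sym3. \<forall>x. x \<noteq> 0 \<longrightarrow> x \<bullet> (U *v x) > 0}"

definition mat_inner :: "real ^ 3 ^ 3 \<Rightarrow> real ^ 3 ^ 3 \<Rightarrow> real" where
  "mat_inner X Y = trace (X ** transpose Y)"

lemma mat_inner_eq_inner: "mat_inner X Y = X \<bullet> Y"
  by (simp add: mat_inner_def trace_def matrix_matrix_mult_def transpose_def inner_vec_def)

text \<open>Maps \<open>Sym\<^sup>+\<^sup>+(3) \<rightarrow> Sym(3)\<close> are represented by total functions on matrices; only their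
  values on \<^const>\<open>Sym3_pd\<close> matter here.\<close>

definition Hilbert_monotone :: "(real ^ 3 ^ 3 \<Rightarrow> real ^ 3 ^ 3) \<Rightarrow> bool" where
  "Hilbert_monotone \<Sigma> \<longleftrightarrow>
     (\<forall>U\<in>Sym3_pd. \<forall>V\<in>Sym3_pd. mat_inner (\<Sigma> U - \<Sigma> V) (U - V) \<ge> 0)"

definition T_Biot :: "real \<Rightarrow> real ^ 3 ^ 3 \<Rightarrow> real ^ 3 ^ 3" where
  "T_Biot M U =
     U + (((M / 2 - 1 / 3) * (det U - 1 / det U) - 1 / det U) * det U) *\<^sub>R matrix_inv U"

lemma Sym3_pd_invertible:
  assumes "U \<in> Sym3_pd"
  shows "invertible U"
proof -
  have "x = 0" if "U *v x = 0" for x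
    using assms that by (force simp: Sym3_pd_def)
  then show ?thesis
    by (metis invertible_left_inverse matrix_left_invertible_ker)
qed

lemma T_Biot_in_Sym3:
  assumes "U \<in> Sym3_pd"
  shows "T_Biot M U \<in> Sym3"
proof -
  have sym: "transpose U = U"
    using assms by (simp add: Sym3_pd_def Sym3_def)
  have inv: "U ** matrix_inv U = mat 1" "matrix_inv U ** U = mat 1"
    using someI_ex[OF Sym3_pd_invertible[OF assms, unfolded invertible_def]]
    by (simp_all add: matrix_inv_def)
  have "transpose (matrix_inv U) ** U = mat 1"
    by (metis inv(1) matrix_transpose_mul sym transpose_mat)
  then have "transpose (matrix_inv U) = matrix_inv U"
    by (metis inv(1) matrix_mul_assoc matrix_mul_lid matrix_mul_rid)
  moreover have "transpose (A + B) = transpose A + transpose B" for A B :: "real ^ 3 ^ 3"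
    by (simp add: transpose_def vec_eq_iff)
  ultimately show ?thesis
    by (simp add: T_Biot_def Sym3_def transpose_scalar sym)
qed

end

theory Submission
  imports Defs
begin

text \<open>On diagonal matrices of a common determinant \<open>d\<close> the Biot stress is
  \<open>U + K U\<^sup>-\<^sup>1\<close> with the fixed factor \<open>K = (M/2 - 1/3)(d\<^sup>2 - 1) - 1\<close>.
  Swapping two principal stretches \<open>x\<close>, \<open>y\<close> keeps \<open>d\<close>, and the monotonicity
  expression becomes \<open>2 (x - y)\<^sup>2 (1 - K / (x y))\<close>, which is negative once the third stretch,
  hence \<open>d\<close> and \<open>K\<close>, is large.\<close>

definition diag3 :: "real \<Rightarrow> real \<Rightarrow> real \<Rightarrow> real ^ 3 ^ 3" where
  "diag3 a b c = (\<chi> i j. if i = j then vector [a, b, c] $ i else 0)"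

lemma diag3_nth:
  "diag3 a b c $ 1 $ 1 = a" "diag3 a b c $ 1 $ 2 = 0" "diag3 a b c $ 1 $ 3 = 0"
  "diag3 a b c $ 2 $ 1 = 0" "diag3 a b c $ 2 $ 2 = b" "diag3 a b c $ 2 $ 3 = 0"
  "diag3 a b c $ 3 $ 1 = 0" "diag3 a b c $ 3 $ 2 = 0" "diag3 a b c $ 3 $ 3 = c"
  by (simp_all add: diag3_def)

lemma diag3_in_Sym3_pd:
  assumes "a > 0" "b > 0" "c > 0"
  shows "diag3 a b c \<in> Sym3_pd"
proof -
  have "transpose (diag3 a b c) = diag3 a b c"
    by (simp add: transpose_def vec_eq_iff diag3_def)
  moreover have "x \<bullet> (diag3 a b c *v x) > 0" if "x \<noteq> 0" for x
  proof -
    have "x $ 1 \<noteq> 0 \<or> x $ 2 \<noteq> 0 \<or> x $ 3 \<noteq> 0"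
      using that by (auto simp: vec_eq_iff forall_3)
    then have "a * (x $ 1)\<^sup>2 > 0 \<or> b * (x $ 2)\<^sup>2 > 0 \<or> c * (x $ 3)\<^sup>2 > 0"
      using assms by auto
    moreover have "a * (x $ 1)\<^sup>2 \<ge> 0" "b * (x $ 2)\<^sup>2 \<ge> 0" "c * (x $ 3)\<^sup>2 \<ge> 0"
      using assms by simp_all
    ultimately have "a * (x $ 1)\<^sup>2 + b * (x $ 2)\<^sup>2 + c * (x $ 3)\<^sup>2 > 0"
      by linarith
    then show ?thesis
      by (simp add: inner_vec_def matrix_vector_mult_def sum_3 diag3_nth power2_eq_square
          algebra_simps)
  qed
  ultimately show ?thesis
    by (simp add: Sym3_pd_def Sym3_def)
qed

lemma det_diag3: "det (diag3 a b c) = a * b * c"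
  by (simp add: det_3 diag3_nth)

lemma diag3_mult: "diag3 a b c ** diag3 a' b' c' = diag3 (a * a') (b * b') (c * c')"
  by (simp add: matrix_matrix_mult_def vec_eq_iff forall_3 sum_3 diag3_nth)

lemma diag3_one: "diag3 1 1 1 = mat 1"
  by (simp add: mat_def vec_eq_iff forall_3 diag3_nth)

lemma matrix_inv_diag3:
  assumes "a \<noteq> 0" "b \<noteq> 0" "c \<noteq> 0"
  shows "matrix_inv (diag3 a b c) = diag3 (1 / a) (1 / b) (1 / c)"
proof -
  have "diag3 a b c ** diag3 (1 / a) (1 / b) (1 / c) = mat 1"
    "diag3 (1 / a) (1 / b) (1 / c) ** diag3 a b c = mat 1"
    using assms by (simp_all add: diag3_mult diag3_one)
  \<comment> \<open>\<open>matrix_inv\<close> is a Hilbert choice, so it satisfies its defining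
    equations only once some two-sided inverse is known. The explicit diagonal matrix is that
    witness; uniqueness of inverses then identifies the two.\<close>
  moreover from this have "matrix_inv (diag3 a b c) ** diag3 a b c = mat 1"
    unfolding matrix_inv_def by (metis (mono_tags, lifting) someI_ex)
  ultimately show ?thesis
    by (metis matrix_mul_assoc matrix_mul_lid matrix_mul_rid)
qed

lemma T_Biot_diag3:
  fixes M :: real
  assumes "a \<noteq> 0" "b \<noteq> 0" "c \<noteq> 0"
  defines "K \<equiv> (M / 2 - 1 / 3) * ((a * b * c)\<^sup>2 - 1) - 1"
  shows "T_Biot M (diag3 a b c) = diag3 (a + K / a) (b + K / b) (c + K / c)"
proof -
  define d where "d = a * b * c"
  have "d \<noteq> 0"
    using assms by (simp add: d_def)
  \<comment> \<open>The outer factor \<open>d\<close>, which comes from the cofactor matrix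
    \<open>(det U) U^{-1}\<close>, clears both reciprocals \<open>1 / d\<close> and leaves a
    polynomial in \<open>d\<close>.\<close>
  then have "((M / 2 - 1 / 3) * (d - 1 / d) - 1 / d) * d = (M / 2 - 1 / 3) * (d\<^sup>2 - 1) - 1"
    by (simp add: field_simps power2_eq_square)
  then have "((M / 2 - 1 / 3) * (d - 1 / d) - 1 / d) * d = K"
    by (simp only: K_def d_def)
  then show ?thesis
    using assms(1-3)
    by (simp add: T_Biot_def det_diag3 matrix_inv_diag3 d_def vec_eq_iff forall_3 diag3_nth)
qed

lemma mat_inner_diff_diag3:
  "mat_inner (diag3 a b c - diag3 a' b' c') (diag3 p q r - diag3 p' q' r') =
    (a - a') * (p - p') + (b - b') * (q - q') + (c - c') * (r - r')"
  by (simp add: mat_inner_eq_inner inner_vec_def sum_3 diag3_nth)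

text \<open>The third entries cancel, and the first two contribute equally: since
  \<open>K / x - K / y = - K (x - y) / (x y)\<close>, each gives
  \<open>(x - y)^2 (1 - K / (x y))\<close>.\<close>

lemma T_Biot_swap:
  assumes "x \<noteq> 0" "y \<noteq> 0" "z \<noteq> 0"
  shows "mat_inner (T_Biot M (diag3 x y z) - T_Biot M (diag3 y x z)) (diag3 x y z - diag3 y x z) =
    2 * (x - y)\<^sup>2 * (1 - ((M / 2 - 1 / 3) * ((x * y * z)\<^sup>2 - 1) - 1) / (x * y))"
proof -
  define K where "K = (M / 2 - 1 / 3) * ((x * y * z)\<^sup>2 - 1) - 1"
  have "T_Biot M (diag3 x y z) = diag3 (x + K / x) (y + K / y) (z + K / z)"
    "T_Biot M (diag3 y x z) = diag3 (y + K / y) (x + K / x) (z + K / z)"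
    \<comment> \<open>Commutativity turns the determinant \<open>y * x * z\<close> into
      \<open>x * y * z\<close>, so both stresses share the same \<open>K\<close>.\<close>
    using assms by (simp_all add: T_Biot_diag3 K_def mult.commute)
  then show ?thesis
    unfolding K_def [symmetric] using assms
    by (simp add: mat_inner_diff_diag3 field_simps power2_eq_square)
qed

theorem proposition4p2:
  fixes M :: real
  assumes "M > 2 / 3"
  shows "\<not> Hilbert_monotone (T_Biot M)"
proof
  assume mono: "Hilbert_monotone (T_Biot M)"
  define k where "k = M / 2 - 1 / 3"
  \<comment> \<open>With stretches 1 and 2 the sign is negative as soon as
    \<open>K = k (4 z^2 - 1) - 1\<close> exceeds \<open>x y = 2\<close>. The summand
    \<open>1 / k\<close> in \<open>z\<close> compensates for small \<open>k\<close>, that is, for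
    \<open>M\<close> close to 2/3: it makes \<open>K > 7\<close> for every
    \<open>k > 0\<close>.\<close>
  define z where "z = 1 + 1 / k"
  have "k > 0"
    using assms by (simp add: k_def)
  then have "z > 0"
    by (simp add: z_def add_pos_pos)
  have "k * ((1 * 2 * z)\<^sup>2 - 1) - 1 = 3 * k + 7 + 4 / k"
    using \<open>k > 0\<close> by (simp add: z_def field_simps power2_eq_square)
  also have "\<dots> > 2"
    using \<open>k > 0\<close> by (simp add: add_pos_pos add_strict_increasing2)
  finally have "k * ((1 * 2 * z)\<^sup>2 - 1) - 1 > 2" .
  \<comment> \<open>Here \<open>(x - y)^2 = 1\<close>, so the value is
    \<open>2 (1 - K / 2) = 2 - K\<close>.\<close>
  then have "mat_inner (T_Biot M (diag3 1 2 z) - T_Biot M (diag3 2 1 z))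
      (diag3 1 2 z - diag3 2 1 z) < 0"
    using \<open>z > 0\<close> by (simp add: T_Biot_swap k_def [symmetric])
  moreover have "diag3 1 2 z \<in> Sym3_pd" "diag3 2 1 z \<in> Sym3_pd"
    using \<open>z > 0\<close> by (simp_all add: diag3_in_Sym3_pd)
  ultimately show False
    using mono unfolding Hilbert_monotone_def by (metis not_le)
qed

end
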